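(* Let $d,k\in\mathbb N^+$ and let $A=A(Q_d)$ be the adjacency matrix of the hypercube $Q_d$. Then $A^k$ has PST between every antipodal pair $x,\bar x$ if and only if $d$ is even or $k$ is odd. More precisely: (i) if $d$ is even, then for every $k\in\mathbb N^+$ the matrix $A^k$ has PST between every antipodal pair, with minimum positive transfer time $\pi/2^k$; (ii) if $d$ is odd, then exactly the odd exponents $k$ have PST between antipodal pairs, with minimum positive transfer time $\pi/2$.
   Context: $\mathbb N^+=\{1,2,3,\ldots\}$. $\mathbb F_2=\mathbb Z/2\mathbb Z$. $Q_d$ is the graph on $\mathbb F_2^d$ in which two words are adjacent when they differ in exactly one coordinate. For $x\in\mathbb F_2^d$, its antipode is $\bar x=x+(1,\ldots,1)$. A real symmetric matrix $K$ indexed by a finite vertex set has perfect state transfer (PST) from vertex $a$ to vertex $b$ at time $\tau>0$ (a transfer time) if $\exp(-\mathrm i\tau K)e_a=\gamma e_b$ for some $\gamma\in\mathbb C$ with $|\gamma|=1$, where $e_v$ is the standard basis vector indexed by $v$; it has PST from $a$ to $b$ if this holds for some $\tau>0$. *)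

theory Defs
  imports "HOL-Analysis.Analysis" "HOL-Library.Z2"
begin

instance bit :: finite
proof
  have "(UNIV :: bit set) \<subseteq> {0, 1}"
    using bit_not_one_iff by blast
  then show "finite (UNIV :: bit set)"
    by (rule finite_subset) simp
qed

(* The product, the power and the exponential that the classes provide on vec are componentwise,
   so the matrix power and the matrix exponential are defined from the matrix product. *)

primrec matrix_power :: "'a::semiring_1 ^ 'v ^ 'v \<Rightarrow> nat \<Rightarrow> 'a ^ 'v ^ 'v" where
  "matrix_power M 0 = mat 1"
| "matrix_power M (Suc n) = M ** matrix_power M n"

definition matrix_exp :: "complex ^ 'v ^ 'v \<Rightarrow> complex ^ 'v ^ 'v" where
  "matrix_exp M = (\<Sum>n. (1 / fact n) *\<^sub>R matrix_power M n)"

definition pst_at :: "real ^ 'v ^ 'v \<Rightarrow> 'v \<Rightarrow> 'v \<Rightarrow> real \<Rightarrow> bool" where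
  "pst_at K a b \<tau> \<longleftrightarrow> \<tau> > 0 \<and>
     (\<exists>\<gamma>::complex. norm \<gamma> = 1 \<and>
        matrix_exp (map_matrix (\<lambda>r. - \<i> * of_real \<tau> * of_real r) K) *v axis a 1 = \<gamma> *s axis b 1)"

definition has_pst :: "real ^ 'v ^ 'v \<Rightarrow> 'v \<Rightarrow> 'v \<Rightarrow> bool" where
  "has_pst K a b \<longleftrightarrow> (\<exists>\<tau>. pst_at K a b \<tau>)"

definition min_transfer_time :: "real ^ 'v ^ 'v \<Rightarrow> 'v \<Rightarrow> 'v \<Rightarrow> real \<Rightarrow> bool" where
  "min_transfer_time K a b \<tau> \<longleftrightarrow> pst_at K a b \<tau> \<and> (\<forall>\<sigma>. pst_at K a b \<sigma> \<longrightarrow> \<tau> \<le> \<sigma>)"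

definition adjacency_matrix :: "('v \<Rightarrow> 'v \<Rightarrow> bool) \<Rightarrow> real ^ 'v ^ 'v" where
  "adjacency_matrix E = (\<chi> u v. if E u v then 1 else 0)"

(* The dimension d of the cube is CARD('d), for an arbitrary finite index type 'd. *)

definition hypercube_adj :: "bit ^ 'd \<Rightarrow> bit ^ 'd \<Rightarrow> bool" where
  "hypercube_adj x y \<longleftrightarrow> (\<exists>!i. x $ i \<noteq> y $ i)"

definition antipode :: "bit ^ 'd \<Rightarrow> bit ^ 'd" where
  "antipode x = x + (\<chi> i. 1)"

definition hypercube_matrix :: "real ^ (bit ^ 'd) ^ (bit ^ 'd)" where
  "hypercube_matrix = adjacency_matrix hypercube_adj"

end

theory Submission
  imports Defs
begin

text \<open>
  The characters \<open>\<chi>\<^sub>S\<close> of the group \<open>\<bbbF>\<^sub>2\<^sup>d\<close> diagonalise \<open>A\<close>: the eigenvalue of \<open>\<chi>\<^sub>S\<close> is \<open>d - 2|S|\<close>, and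
  \<open>\<chi>\<^sub>S\<close> of an antipode picks up the sign \<open>(-1)\<^bsup>|S|\<^esup>\<close>. Hence transfer at time \<open>\<tau>\<close> means that
  \<open>exp(-i\<tau>(d - 2j)\<^sup>k) = \<gamma>(-1)\<^sup>j\<close> for all \<open>j \<le> d\<close>. The lower bounds on \<open>\<tau>\<close>, and the failure for \<open>d\<close> odd and
  \<open>k\<close> even, already come from the two values of \<open>d - 2j\<close> closest to \<open>0\<close>. Sufficiency follows from
  \<open>m\<^sup>k \<equiv> m\<close> mod \<open>2\<close>, and from \<open>m\<^sup>k \<equiv> m\<close> mod \<open>4\<close> for \<open>m\<close> and \<open>k\<close> odd.
\<close>

section \<open>Characters of F_2^d and their orthogonality\<close>

definition chi :: "bit ^ 'd \<Rightarrow> bit ^ 'd \<Rightarrow> 'a::comm_ring_1" where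
  "chi S x = (\<Prod>i\<in>UNIV. if S $ i = 1 \<and> x $ i = 1 then -1 else 1)"

definition weight :: "bit ^ 'd \<Rightarrow> nat" where
  "weight S = card {i. S $ i = 1}"

text \<open>This is the spectral form: the symmetric matrix with eigenvectors \<open>chi S\<close>
  and eigenvalues \<open>f S\<close>. The entry type stays open so that the real adjacency matrix
  and the complex exponential share one calculus.\<close>

definition char_matrix :: "(bit ^ 'd \<Rightarrow> 'a) \<Rightarrow> 'a::field_char_0 ^ (bit ^ 'd) ^ (bit ^ 'd)" where
  "char_matrix f = (\<chi> x y. (\<Sum>S\<in>UNIV. f S * chi S x * chi S y) / of_nat CARD(bit ^ 'd))"

lemma bit_vec_add_self [simp]: "x + x = (0 :: bit ^ 'd)"
  by (simp add: vec_eq_iff)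

lemma bit_vec_add_eq_0_iff: "x + y = 0 \<longleftrightarrow> x = (y :: bit ^ 'd)"
  by (metis add.assoc add.right_neutral bit_vec_add_self add.left_neutral)

lemma chi_commute: "chi S x = chi x S"
  by (simp add: chi_def conj_commute)

lemma chi_add: "chi S (x + y) = (chi S x * chi S y :: 'a::comm_ring_1)"
  unfolding chi_def prod.distrib[symmetric]
proof (rule prod.cong)
  fix i
  show "(if S $ i = 1 \<and> (x + y) $ i = 1 then -1 else 1) =
        (if S $ i = 1 \<and> x $ i = 1 then -1 else 1) * (if S $ i = 1 \<and> y $ i = 1 then -1 else (1::'a))"
    by (cases "x $ i"; cases "y $ i") auto
qed simp

lemma chi_0 [simp]: "chi S 0 = 1"
  by (simp add: chi_def)

lemma chi_mult_self [simp]: "chi S x * chi S x = 1"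
  by (metis chi_add bit_vec_add_self chi_0)

lemma of_real_chi [simp]: "of_real (chi S x) = (chi S x :: 'a::{real_algebra_1,comm_ring_1})"
  unfolding chi_def of_real_prod by (rule prod.cong) auto

lemma chi_axis: "chi S (axis i 1) = (if S $ i = 1 then -1 else 1 :: 'a::comm_ring_1)"
proof -
  have "chi S (axis i 1) = (\<Prod>j\<in>UNIV. if j = i then (if S $ i = 1 then -1 else 1) else (1::'a))"
    unfolding chi_def by (rule prod.cong) (auto simp: axis_def)
  then show ?thesis by simp
qed

lemma chi_ones: "chi S (\<chi> i. 1) = (-1) ^ weight S"
  by (simp add: chi_def weight_def prod.If_cases)

text \<open>If \<open>z $ i = 1\<close>, translating \<open>S\<close> by the unit vector
  \<open>axis i 1\<close> permutes the index set and flips the sign of every term, so the sum equals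
  its own negative.\<close>

lemma sum_chi:
  "(\<Sum>S\<in>UNIV. chi S z) = (if z = 0 then of_nat CARD(bit ^ 'd) else (0 :: 'a::field_char_0))"
  for z :: "bit ^ 'd"
proof (cases "z = 0")
  case False
  then obtain i where i: "z $ i = 1"
    by (auto simp: vec_eq_iff)
  have "(\<Sum>S\<in>UNIV. chi S z) = (\<Sum>S\<in>UNIV. chi (S + axis i 1) z :: 'a)"
    by (rule sum.reindex_bij_witness[of _ "\<lambda>S. S + axis i 1" "\<lambda>S. S + axis i 1"])
       (auto simp: add.assoc)
  also have "\<dots> = (\<Sum>S\<in>UNIV. - chi S z)"
    using i by (simp add: chi_commute[of _ z] chi_add chi_axis)
  finally show ?thesis
    using False by (simp add: sum_negf)
qed simp

lemma sum_chi_chi: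
  "(\<Sum>S\<in>UNIV. chi S x * chi S y) = (if x = y then of_nat CARD(bit ^ 'd) else (0 :: 'a::field_char_0))"
  for x y :: "bit ^ 'd"
  by (simp add: chi_add[symmetric] sum_chi bit_vec_add_eq_0_iff)

lemma sum_chi_chi':
  "(\<Sum>x\<in>UNIV. chi S x * chi T x) = (if S = T then of_nat CARD(bit ^ 'd) else (0 :: 'a::field_char_0))"
  for S T :: "bit ^ 'd"
  using sum_chi_chi[of S T] by (simp add: chi_commute)

section \<open>Functional calculus for matrices diagonal in the characters\<close>

lemma char_matrix_chi:
  "(\<Sum>y\<in>UNIV. char_matrix f $ x $ y * chi T y) = f T * chi T x"
  for x :: "bit ^ 'd" and f :: "bit ^ 'd \<Rightarrow> 'a::field_char_0"
proof -
  have "(\<Sum>y\<in>UNIV. char_matrix f $ x $ y * chi T y) =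
      (\<Sum>y\<in>UNIV. \<Sum>S\<in>UNIV. f S * chi S x / of_nat CARD(bit ^ 'd) * (chi S y * chi T y))"
    by (simp add: char_matrix_def sum_divide_distrib sum_distrib_right sum_distrib_left mult.assoc)
  also have "\<dots> = (\<Sum>S\<in>UNIV. f S * chi S x / of_nat CARD(bit ^ 'd) * (\<Sum>y\<in>UNIV. chi S y * chi T y))"
    by (subst sum.swap) (simp only: sum_distrib_left)
  also have "\<dots> = (\<Sum>S\<in>UNIV. if S = T then f S * chi S x else 0)"
    unfolding sum_chi_chi' by (rule sum.cong) auto
  finally show ?thesis by simp
qed

lemma char_matrix_transpose: "char_matrix f $ x $ y = char_matrix f $ y $ x"
  by (simp add: char_matrix_def mult.assoc mult.commute[of "chi _ x"])

text \<open>The columns of \<open>char_matrix g\<close> are combinations of characters, and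
  \<open>char_matrix f\<close> rescales each character by its eigenvalue.\<close>

lemma char_matrix_mult: "char_matrix f ** char_matrix g = char_matrix (\<lambda>S. f S * g S)"
  for f g :: "bit ^ 'd \<Rightarrow> 'a::field_char_0"
proof -
  have "(char_matrix f ** char_matrix g) $ x $ z = char_matrix (\<lambda>S. f S * g S) $ x $ z" for x z
  proof -
    have "(char_matrix f ** char_matrix g) $ x $ z =
        (\<Sum>y\<in>UNIV. \<Sum>S\<in>UNIV. char_matrix f $ x $ y * chi S y * (g S * chi S z / of_nat CARD(bit ^ 'd)))"
      by (simp add: matrix_matrix_mult_def char_matrix_def[of g] sum_divide_distrib sum_distrib_left ac_simps)
    also have "\<dots> = (\<Sum>S\<in>UNIV. (\<Sum>y\<in>UNIV. char_matrix f $ x $ y * chi S y) *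
          (g S * chi S z / of_nat CARD(bit ^ 'd)))"
      by (subst sum.swap) (simp only: sum_distrib_right)
    also have "\<dots> = char_matrix (\<lambda>S. f S * g S) $ x $ z"
      unfolding char_matrix_chi by (simp add: char_matrix_def sum_divide_distrib ac_simps)
    finally show ?thesis .
  qed
  then show ?thesis by (simp add: vec_eq_iff)
qed

lemma char_matrix_1: "char_matrix (\<lambda>_. 1) = mat 1"
  by (simp add: char_matrix_def mat_def vec_eq_iff sum_chi_chi)

lemma matrix_power_char_matrix: "matrix_power (char_matrix f) n = char_matrix (\<lambda>S. f S ^ n)"
  by (induction n) (simp_all add: char_matrix_1 char_matrix_mult)

lemma map_matrix_char_matrix:
  "map_matrix (\<lambda>r. c * of_real r) (char_matrix f) = char_matrix (\<lambda>S. c * of_real (f S) :: complex)"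
  by (simp add: map_matrix_def char_matrix_def vec_eq_iff sum_distrib_left mult.assoc)

lemma sums_vecI: "(\<And>i. (\<lambda>n. f n $ i) sums (l $ i)) \<Longrightarrow> f sums l"
  for f :: "nat \<Rightarrow> 'a::real_normed_vector ^ 'n"
  unfolding sums_def by (rule vec_tendstoI) simp

text \<open>Powers act on the eigenvalues, so each entry of the series is a finite combination of
  scalar exponential series, one for each \<open>S\<close>.\<close>

lemma matrix_exp_char_matrix: "matrix_exp (char_matrix f) = char_matrix (\<lambda>S. exp (f S))"
proof -
  have "(\<lambda>n. ((1 / fact n) *\<^sub>R matrix_power (char_matrix f) n) $ x $ y)
      sums (char_matrix (\<lambda>S. exp (f S)) $ x $ y)" for x y
  proof -
    have "(\<lambda>n. (\<Sum>S\<in>UNIV. (f S ^ n /\<^sub>R fact n) * chi S x * chi S y) / of_nat CARD(bit ^ 'a))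
      sums ((\<Sum>S\<in>UNIV. exp (f S) * chi S x * chi S y) / of_nat CARD(bit ^ 'a))"
      by (intro sums_divide sums_sum sums_mult2 exp_converges)
    then show ?thesis
      unfolding matrix_power_char_matrix vector_scaleR_component
      by (simp add: char_matrix_def scaleR_conv_of_real sum_distrib_left sum_divide_distrib inverse_eq_divide mult.assoc)
  qed
  then have "(\<lambda>n. (1 / fact n) *\<^sub>R matrix_power (char_matrix f) n) sums char_matrix (\<lambda>S. exp (f S))"
    by (intro sums_vecI) auto
  then show ?thesis
    unfolding matrix_exp_def by (rule sums_unique[symmetric])
qed

section \<open>Spectrum of the hypercube\<close>

lemma sum_chi_axis:
  fixes S :: "bit ^ 'd"
  shows "(\<Sum>i\<in>UNIV. chi S (axis i 1)) = (of_nat CARD('d) - 2 * of_nat (weight S) :: 'a::comm_ring_1)"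
proof -
  have "card (UNIV - {i. S $ i = 1}) + weight S = CARD('d)"
    unfolding weight_def by (metis card_Diff_subset card_mono finite le_add_diff_inverse2 subset_UNIV)
  then have "(of_nat CARD('d) :: 'a) = of_nat (card (- {i. S $ i = 1})) + of_nat (weight S)"
    by (metis Compl_eq_Diff_UNIV of_nat_add)
  then show ?thesis
    by (simp add: chi_axis sum.If_cases weight_def)
qed

lemma hypercube_adj_iff: "hypercube_adj x y \<longleftrightarrow> (\<exists>i. x + y = axis i 1)"
proof -
  have *: "a + b = (if P then 1 else 0) \<longleftrightarrow> (a \<noteq> b \<longleftrightarrow> P)" for a b :: bit and P
    by (cases a; cases b; simp)
  have "x + y = axis i 1 \<longleftrightarrow> (\<forall>j. x $ j \<noteq> y $ j \<longleftrightarrow> j = i)" for i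
    by (simp only: vec_eq_iff axis_def vec_lambda_beta vector_add_component *)
  then show ?thesis
    unfolding hypercube_adj_def Ex1_def by (metis (mono_tags))
qed

text \<open>The cube is the Cayley graph of F_2^d on the unit vectors, so its eigenvalue at
  \<open>chi S\<close> is the sum of \<open>chi S\<close> over them. With the eigenvalue written
  this way, orthogonality turns the sum over \<open>S\<close> into a test whether
  \<open>x + y\<close> is the \<open>i\<close>-th unit vector.\<close>

lemma hypercube_matrix_eq:
  "hypercube_matrix = char_matrix (\<lambda>S :: bit ^ 'd. real CARD('d::finite) - 2 * real (weight S))"
proof -
  have "(\<Sum>S\<in>UNIV. (\<Sum>i\<in>UNIV. chi S (axis i 1)) * chi S x * chi S y) / real CARD(bit ^ 'd) =
      (if hypercube_adj x y then 1 else 0)" (is "?l / _ = _") for x y :: "bit ^ 'd"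
  proof -
    have "?l = (\<Sum>i\<in>UNIV. \<Sum>S\<in>UNIV. chi S (x + y) * chi S (axis i 1))"
      by (subst sum.swap) (simp add: sum_distrib_left sum_distrib_right chi_add ac_simps)
    also have "\<dots> = (\<Sum>i\<in>UNIV. if x + y = axis i 1 then real CARD(bit ^ 'd) else 0)"
      by (simp only: sum_chi_chi)
    also have "\<dots> = (if hypercube_adj x y then real CARD(bit ^ 'd) else 0)"
    proof (cases "hypercube_adj x y")
      case True
      then obtain i where i: "x + y = axis i 1" by (auto simp: hypercube_adj_iff)
      then have "(x + y = axis j 1) = (j = i)" for j by (auto simp: axis_eq_axis)
      then show ?thesis using True by simp
    qed (auto simp: hypercube_adj_iff)
    finally show ?thesis by simp
  qed
  then show ?thesis
    by (simp add: hypercube_matrix_def adjacency_matrix_def char_matrix_def vec_eq_iff sum_chi_axis)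
qed

section \<open>Transfer as a condition on eigenvalues\<close>

lemma matrix_vector_mult_axis: "(M *v axis a 1) $ x = M $ x $ a"
  for M :: "'a::semiring_1 ^ 'n ^ 'm"
  by (simp add: matrix_vector_mult_def axis_def if_distrib[of "\<lambda>z. _ * z"] cong: if_cong)

text \<open>One column determines every eigenvalue: by symmetry it is also a row, pairing it with
  \<open>chi S\<close> gives \<open>f S * chi S a\<close>, and \<open>chi S a\<close> is its own
  inverse.\<close>

lemma char_matrix_axis_inj:
  assumes "char_matrix f *v axis a 1 = char_matrix g *v axis a 1"
  shows "f = (g :: bit ^ 'd \<Rightarrow> complex)"
proof
  fix S
  have "char_matrix f $ x $ a = char_matrix g $ x $ a" for x
    using assms by (metis matrix_vector_mult_axis)
  then have "(\<Sum>y\<in>UNIV. char_matrix f $ a $ y * chi S y) = (\<Sum>y\<in>UNIV. char_matrix g $ a $ y * chi S y)"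
    by (simp add: char_matrix_transpose[of _ a])
  then have "f S * chi S a * chi S a = g S * chi S a * chi S a"
    by (simp add: char_matrix_chi)
  then show "f S = g S" by (simp add: mult.assoc)
qed

text \<open>Passing to the antipode multiplies \<open>chi S\<close> by a sign depending on the
  weight. The target vector thus becomes column \<open>a\<close> of a matrix in the same family,
  ready for comparison of eigenvalues.\<close>

lemma axis_antipode:
  "\<gamma> *s axis (antipode a) 1 = char_matrix (\<lambda>S. \<gamma> * (-1) ^ weight S) *v axis a (1::complex)"
  for a :: "bit ^ 'd"
proof -
  have "(\<Sum>S\<in>UNIV. \<gamma> * (-1) ^ weight S * chi S x * chi S a) / of_nat CARD(bit ^ 'd) =
      (if x = antipode a then \<gamma> else 0)" for x
  proof -
    have "(\<Sum>S\<in>UNIV. \<gamma> * (-1) ^ weight S * chi S x * chi S a) = \<gamma> * (\<Sum>S\<in>UNIV. chi S x * chi S (antipode a))"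
      by (simp add: antipode_def chi_add chi_ones sum_distrib_left ac_simps)
    then show ?thesis by (simp add: sum_chi_chi)
  qed
  then show ?thesis
    by (simp add: vec_eq_iff[of "_ *s _"] matrix_vector_mult_axis) (simp add: char_matrix_def axis_def)
qed

lemma weight_le: "weight (S :: bit ^ 'd) \<le> CARD('d::finite)"
  unfolding weight_def by (rule card_mono) auto

lemma ex_weight:
  assumes "j \<le> CARD('d::finite)"
  obtains S :: "bit ^ 'd" where "weight S = j"
proof -
  obtain T :: "'d set" where "card T = j"
    using assms obtain_subset_with_card_n by blast
  then have "weight (\<chi> i. if i \<in> T then 1 else 0) = j"
    by (simp add: weight_def)
  then show ?thesis by (rule that)
qed

text \<open>Both sides of the transfer equation are column \<open>x\<close> of a character matrix,
  so their eigenvalues must agree. These depend only on the weight of \<open>S\<close>, and every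
  weight up to the dimension occurs. Integer eigenvalues make parity and congruence arguments
  available.\<close>

lemma pst_at_hypercube_iff:
  fixes x :: "bit ^ 'd"
  shows "pst_at (matrix_power hypercube_matrix k) x (antipode x) \<tau> \<longleftrightarrow>
     \<tau> > 0 \<and> (\<exists>\<gamma>. norm \<gamma> = 1 \<and>
       (\<forall>j\<le>CARD('d). cis (- (\<tau> * of_int ((int CARD('d) - 2 * int j) ^ k))) = \<gamma> * (-1) ^ j))"
proof -
  define F where "F j = cis (- (\<tau> * of_int ((int CARD('d) - 2 * int j) ^ k)))" for j
  have "matrix_exp (map_matrix (\<lambda>r. - \<i> * of_real \<tau> * of_real r) (matrix_power hypercube_matrix k)) =
      char_matrix (\<lambda>S :: bit ^ 'd. F (weight S))"
    unfolding hypercube_matrix_eq matrix_power_char_matrix map_matrix_char_matrix matrix_exp_char_matrix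
    by (simp add: F_def cis_conv_exp mult.assoc)
  moreover have "char_matrix (\<lambda>S. F (weight S)) *v axis x 1 = \<gamma> *s axis (antipode x) 1 \<longleftrightarrow>
      (\<forall>j\<le>CARD('d). F j = \<gamma> * (-1) ^ j)" for \<gamma>
  proof -
    have "char_matrix (\<lambda>S. F (weight S)) *v axis x 1 = \<gamma> *s axis (antipode x) 1 \<longleftrightarrow>
        (\<forall>S :: bit ^ 'd. F (weight S) = \<gamma> * (-1) ^ weight S)"
      unfolding axis_antipode by (auto dest!: char_matrix_axis_inj simp: fun_eq_iff)
    also have "\<dots> \<longleftrightarrow> (\<forall>j\<le>CARD('d). F j = \<gamma> * (-1) ^ j)"
      by (metis weight_le ex_weight)
    finally show ?thesis .
  qed
  ultimately show ?thesis
    by (simp add: pst_at_def F_def)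
qed

section \<open>Arithmetic of the phases and transfer times\<close>

lemma cis_minus_pi_mult_int: "cis (- (pi * of_int n)) = (if even n then 1 else -1)"
  by (auto simp: complex_eq_iff cos_npi_int sin_npi_int)

text \<open>An odd square is 1 modulo 4, hence so is every power of it, and an odd exponent leaves
  one factor \<open>m\<close>.\<close>

lemma odd_power_cong_4:
  fixes m :: int
  assumes "odd m" "odd k"
  obtains q where "m ^ k = m + 4 * q"
proof -
  obtain l where l: "k = 2 * l + 1" using assms(2) by (elim oddE)
  obtain n where n: "m = 2 * n + 1" using assms(1) by (elim oddE)
  have "m\<^sup>2 - 1 = 4 * (n * (n + 1))" by (simp add: n power2_eq_square algebra_simps)
  then have "4 dvd (m\<^sup>2) ^ l - 1" by (simp add: power_diff_1_eq)
  then have "4 dvd m * ((m\<^sup>2) ^ l - 1)" by simp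
  then obtain q where "m * ((m\<^sup>2) ^ l - 1) = 4 * q" by blast
  then show ?thesis
    by (intro that[of q]) (simp add: l power_mult[symmetric] algebra_simps)
qed

lemma min_transfer_time_even:
  fixes x :: "bit ^ 'd"
  assumes "even CARD('d)" and k: "k \<ge> 1"
  shows "min_transfer_time (matrix_power hypercube_matrix k) x (antipode x) (pi / 2 ^ k)"
proof -
  obtain m where m: "CARD('d) = 2 * m" using assms(1) by blast
  \<comment> \<open>The index type is nonempty, so the dimension is positive and
    \<open>m - 1\<close> below is a genuine weight.\<close>
  have m1: "m \<ge> 1" using m zero_less_card_finite[where 'a='d] by linarith
  have "cis (- (pi / 2 ^ k * of_int ((int CARD('d) - 2 * int j) ^ k))) = (-1) ^ m * (-1) ^ j" for j
  proof -
    \<comment> \<open>The factor \<open>2 ^ k\<close> cancels against the time, leaving a multiple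
      of pi with the parity of \<open>m - j\<close>.\<close>
    have "int CARD('d) - 2 * int j = 2 * (int m - int j)" by (simp add: m)
    then have "pi / 2 ^ k * of_int ((int CARD('d) - 2 * int j) ^ k) = pi * of_int ((int m - int j) ^ k)"
      by (simp only: power_mult_distrib of_int_mult of_int_power) simp
    then show ?thesis
      using k by (simp add: cis_minus_pi_mult_int minus_one_power_iff del: of_int_power)
  qed
  then have pst: "pst_at (matrix_power hypercube_matrix k) x (antipode x) (pi / 2 ^ k)"
    unfolding pst_at_hypercube_iff by (intro conjI exI[of _ "(-1) ^ m"]) (auto simp: norm_power)
  have "pi / 2 ^ k \<le> \<sigma>" if \<sigma>_pst: "pst_at (matrix_power hypercube_matrix k) x (antipode x) \<sigma>" for \<sigma>
  proof -
    obtain \<gamma> where \<sigma>: "\<sigma> > 0" and \<gamma>: "\<forall>j\<le>CARD('d). cis (- (\<sigma> * of_int ((int CARD('d) - 2 * int j) ^ k))) = \<gamma> * (-1) ^ j"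
      using \<sigma>_pst unfolding pst_at_hypercube_iff by blast
    \<comment> \<open>Weight \<open>m\<close> has eigenvalue 0 and so fixes \<gamma>; weight
      \<open>m - 1\<close> has eigenvalue 2 and must then give phase factor -1.\<close>
    have "\<gamma> * (-1) ^ m = 1" using \<gamma>[rule_format, of m] k by (simp add: m power_0_left)
    moreover have "cis (- (\<sigma> * 2 ^ k)) = \<gamma> * (-1) ^ (m - 1)"
      using \<gamma>[rule_format, of "m - 1"] m1 by (simp add: m of_nat_diff)
    moreover have "(-1) ^ m = - ((-1) ^ (m - 1) :: complex)"
      using m1 by (cases m) auto
    ultimately have "cis (- (\<sigma> * 2 ^ k)) = -1"
      by (metis minus_minus mult_minus_right)
    then have "cos (\<sigma> * 2 ^ k) = -1" by (simp add: complex_eq_iff)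
    \<comment> \<open>Cosine decreases strictly on [0, pi], so it cannot reach -1 at a positive
      argument below pi.\<close>
    then have "pi \<le> \<sigma> * 2 ^ k"
      using cos_monotone_0_pi[of "\<sigma> * 2 ^ k" pi] \<sigma> by fastforce
    then show ?thesis by (simp add: field_simps)
  qed
  with pst show ?thesis by (simp add: min_transfer_time_def)
qed

lemma min_transfer_time_odd:
  fixes x :: "bit ^ 'd"
  assumes "odd CARD('d)" "odd k"
  shows "min_transfer_time (matrix_power hypercube_matrix k) x (antipode x) (pi / 2)"
proof -
  obtain m where m: "CARD('d) = 2 * m + 1" using assms(1) by (elim oddE)
  have "cis (- (pi / 2 * of_int ((int CARD('d) - 2 * int j) ^ k))) =
      cis (- (pi / 2 * CARD('d))) * (-1) ^ j" for j
  proof -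
    have "odd (int CARD('d) - 2 * int j)" by (simp add: m)
    then obtain q where q: "(int CARD('d) - 2 * int j) ^ k = int CARD('d) - 2 * int j + 4 * q"
      using odd_power_cong_4 assms(2) by blast
    \<comment> \<open>Relative to exponent 1, the phase changes by 2 pi \<open>q\<close>, a whole
      number of turns. What remains is a shift by pi \<open>j\<close> from the phase of weight 0 at
      exponent 1, which supplies \<gamma>.\<close>
    have "- (pi / 2 * of_int ((int CARD('d) - 2 * int j) ^ k)) =
        - (pi / 2 * CARD('d)) + - (pi * of_int (2 * q - int j))"
      unfolding q by (simp add: algebra_simps)
    then show ?thesis
      by (simp only: cis_mult[symmetric] cis_minus_pi_mult_int) (simp add: minus_one_power_iff)
  qed
  then have pst: "pst_at (matrix_power hypercube_matrix k) x (antipode x) (pi / 2)"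
    unfolding pst_at_hypercube_iff by (intro conjI exI[of _ "cis (- (pi / 2 * CARD('d)))"]) auto
  have "pi / 2 \<le> \<sigma>" if \<sigma>_pst: "pst_at (matrix_power hypercube_matrix k) x (antipode x) \<sigma>" for \<sigma>
  proof -
    obtain \<gamma> where \<sigma>: "\<sigma> > 0" and \<gamma>: "\<forall>j\<le>CARD('d). cis (- (\<sigma> * of_int ((int CARD('d) - 2 * int j) ^ k))) = \<gamma> * (-1) ^ j"
      using \<sigma>_pst unfolding pst_at_hypercube_iff by blast
    \<comment> \<open>Weights \<open>m\<close> and \<open>m + 1\<close> have eigenvalues 1 and -1,
      which an odd power preserves.\<close>
    have "cis (- \<sigma>) = \<gamma> * (-1) ^ m" using \<gamma>[rule_format, of m] by (simp add: m)
    moreover have "cis \<sigma> = - (\<gamma> * (-1) ^ m)" using \<gamma>[rule_format, of "m + 1"] assms(2) by (simp add: m)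
    ultimately have "cis \<sigma> = - cis (- \<sigma>)" by simp
    then have "cos \<sigma> = 0" by (simp add: complex_eq_iff)
    \<comment> \<open>Cosine is positive between -pi/2 and pi/2, so its first positive zero is
      pi/2.\<close>
    then show ?thesis using cos_gt_zero_pi[of \<sigma>] \<sigma> pi_gt_zero by fastforce
  qed
  with pst show ?thesis by (simp add: min_transfer_time_def)
qed

text \<open>An even power merges the eigenvalues 1 and -1 of the two middle weights, while transfer
  demands opposite signs there; a number of modulus 1 is not its own negative.\<close>

lemma not_has_pst_odd:
  fixes x :: "bit ^ 'd"
  assumes "odd CARD('d)" "even k"
  shows "\<not> has_pst (matrix_power hypercube_matrix k) x (antipode x)"
proof
  obtain m where m: "CARD('d) = 2 * m + 1" using assms(1) by (elim oddE)
  assume "has_pst (matrix_power hypercube_matrix k) x (antipode x)"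
  then obtain \<sigma> \<gamma> where norm: "norm \<gamma> = 1"
    and \<gamma>: "\<forall>j\<le>CARD('d). cis (- (\<sigma> * of_int ((int CARD('d) - 2 * int j) ^ k))) = \<gamma> * (-1) ^ j"
    unfolding has_pst_def pst_at_hypercube_iff by blast
  have "cis (- \<sigma>) = \<gamma> * (-1) ^ m" using \<gamma>[rule_format, of m] by (simp add: m)
  moreover have "cis (- \<sigma>) = - (\<gamma> * (-1) ^ m)" using \<gamma>[rule_format, of "m + 1"] assms(2) by (simp add: m)
  ultimately have "cis (- \<sigma>) = 0" by simp
  then show False by simp
qed

theorem theorem5p3:
  "(\<forall>k::nat. k \<ge> 1 \<longrightarrow>
      ((\<forall>x::bit ^ 'd. has_pst (matrix_power hypercube_matrix k) x (antipode x)) \<longleftrightarrow>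
         even CARD('d) \<or> odd k))
 \<and> (even CARD('d) \<longrightarrow>
      (\<forall>k::nat. k \<ge> 1 \<longrightarrow>
         (\<forall>x::bit ^ 'd.
            has_pst (matrix_power hypercube_matrix k) x (antipode x) \<and>
            min_transfer_time (matrix_power hypercube_matrix k) x (antipode x) (pi / 2 ^ k))))
 \<and> (odd CARD('d) \<longrightarrow>
      (\<forall>k::nat. k \<ge> 1 \<longrightarrow>
         (\<forall>x::bit ^ 'd.
            (has_pst (matrix_power hypercube_matrix k) x (antipode x) \<longleftrightarrow> odd k) \<and>
            (odd k \<longrightarrow>
               min_transfer_time (matrix_power hypercube_matrix k) x (antipode x) (pi / 2)))))"
proof -
  have has: "has_pst K x y" if "min_transfer_time K x y \<tau>" for K :: "real ^ (bit ^ 'd) ^ (bit ^ 'd)" and x y \<tau>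
    using that by (auto simp: min_transfer_time_def has_pst_def)
  show ?thesis
    using min_transfer_time_even[where 'd='d] min_transfer_time_odd[where 'd='d] not_has_pst_odd[where 'd='d] has
    by meson
qed

end
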